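(* For $\lambda\in\mathbb{C}$ and $k\in\mathbb{N}_0$, there are the mutually inverse sums (identities in the real variable $x$) $$\frac{C_k^{\lambda}(x)}{2^k(x-1)^k}=\sum_{m=0}^{k}\frac{g_{k-m}\left(k+\lambda-\frac12\right)(\lambda)_{k-m}}{(k+2\lambda)_{k-m}}\;\frac{C_m^{k-m+\lambda}\left(\frac1x\right)}{2^m\left(1-\frac1x\right)^m},$$ $$\frac{C_k^{\lambda}\left(\frac1x\right)}{2^k\left(1-\frac1x\right)^k}=\sum_{m=0}^{k}\frac{g_{k-m}\left(\frac12-k-\lambda\right)(\lambda)_{k-m}}{(k+2\lambda)_{k-m}}\;\frac{C_m^{k-m+\lambda}(x)}{2^m(x-1)^m}.$$
   Context: $\mathbb{N}_0=\{0,1,2,\dots\}$; $(a)_n=\Gamma(a+n)/\Gamma(a)=a(a+1)\cdots(a+n-1)$, $(a)_0=1$. $C_k^{\lambda}(x)=\sum_{j=0}^{[k/2]}\frac{(-1)^j(\lambda)_{k-j}}{j!\,(k-2j)!}(2x)^{k-2j}$ is the Gegenbauer polynomial ($[\cdot]$ is the integer part). The Mittag-Leffler polynomials $g_n(\sigma)$ are defined by $\left(\frac{1+z}{1-z}\right)^\sigma=\sum_{n=0}^\infty g_n(\sigma)z^n$, $|z|<1$.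
   Formalization: The sums are undefined when (k+2λ)_k=0 (e.g. k=1, λ=-1/2), so the identities and their mutual inversion are stated for (k+2λ)_k≠0 and real x≠0,1; for every complex λ the right-hand sides are shown to tend to the left-hand sides as the parameter tends to λ. *)

theory Defs
  imports "HOL-Complex_Analysis.Complex_Analysis"
begin

definition gegenbauer :: "nat \<Rightarrow> complex \<Rightarrow> complex \<Rightarrow> complex" where
  "gegenbauer k lam x =
     (\<Sum>j\<le>k div 2. (-1) ^ j * pochhammer lam (k - j) / (fact j * fact (k - 2 * j))
                     * (2 * x) ^ (k - 2 * j))"

text \<open>
  For \<open>norm z < 1\<close> the number \<open>(1 + z) / (1 - z)\<close> has positive real part, so that the
  principal power is the branch with value 1 at \<open>z = 0\<close> and is holomorphic there.
  The description is proper for every \<open>\<sigma>\<close>, see \<open>mittag_leffler_ex1\<close> below.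
\<close>

definition mittag_leffler :: "complex \<Rightarrow> nat \<Rightarrow> complex" where
  "mittag_leffler \<sigma> =
     (THE g. \<forall>z. norm z < 1 \<longrightarrow> (\<lambda>n. g n * z ^ n) sums (((1 + z) / (1 - z)) powr \<sigma>))"

lemma Re_cayley_pos:
  fixes z :: complex
  assumes "norm z < 1"
  shows "Re ((1 + z) / (1 - z)) > 0"
proof -
  have ne: "1 - z \<noteq> 0" using assms by auto
  have n2: "(Re z)\<^sup>2 + (Im z)\<^sup>2 < 1"
    using assms by (simp add: cmod_def)
  have "Re ((1 + z) / (1 - z)) =
      (1 - ((Re z)\<^sup>2 + (Im z)\<^sup>2)) / ((Re (1 - z))\<^sup>2 + (Im (1 - z))\<^sup>2)"
    by (simp add: Re_divide power2_eq_square algebra_simps)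
  moreover have "(Re (1 - z))\<^sup>2 + (Im (1 - z))\<^sup>2 > 0"
    using ne by (metis complex_neq_0)
  ultimately show ?thesis using n2 by (metis diff_gt_0_iff_gt divide_pos_pos)
qed

lemma mittag_leffler_ex1:
  fixes \<sigma> :: complex
  shows "\<exists>!g. \<forall>z. norm z < 1 \<longrightarrow> (\<lambda>n. g n * z ^ n) sums (((1 + z) / (1 - z)) powr \<sigma>)"
proof (rule ex_ex1I)
  define f where "f = (\<lambda>z::complex. ((1 + z) / (1 - z)) powr \<sigma>)"
  have hol: "f holomorphic_on ball 0 1"
    unfolding f_def
  proof (intro holomorphic_intros)
    fix z :: complex
    assume "z \<in> ball 0 1"
    then have z: "norm z < 1" by simp
    show "1 - z \<noteq> 0" using z by auto
    show "(1 + z) / (1 - z) \<notin> \<real>\<^sub>\<le>\<^sub>0"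
      using Re_cayley_pos[OF z] by (auto elim!: nonpos_Reals_cases)
  qed
  have "\<forall>z. norm z < 1 \<longrightarrow> (\<lambda>n. (deriv ^^ n) f 0 / fact n * z ^ n) sums f z"
    using holomorphic_power_series[OF hol] by simp
  then show "\<exists>g. \<forall>z. norm z < 1 \<longrightarrow> (\<lambda>n. g n * z ^ n) sums (((1 + z) / (1 - z)) powr \<sigma>)"
    by (intro exI[where x = "\<lambda>n. (deriv ^^ n) f 0 / fact n"]) (simp add: f_def)
next
  fix g h :: "nat \<Rightarrow> complex"
  assume g: "\<forall>z. norm z < 1 \<longrightarrow> (\<lambda>n. g n * z ^ n) sums (((1 + z) / (1 - z)) powr \<sigma>)"
    and h: "\<forall>z. norm z < 1 \<longrightarrow> (\<lambda>n. h n * z ^ n) sums (((1 + z) / (1 - z)) powr \<sigma>)"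
  have d: "(\<lambda>n. (g n - h n) * z ^ n) sums 0" if "norm z < 1" for z
    using sums_diff[OF g[rule_format, OF that] h[rule_format, OF that]]
    by (simp add: algebra_simps)
  have d0: "g 0 - h 0 = 0"
    using sums_unique2[OF d[of 0] powser_sums_zero[of "\<lambda>n. g n - h n"]] by simp
  have "g n - h n = 0" for n
  proof (rule ccontr)
    assume n: "g n - h n \<noteq> 0"
    then have "n > 0" using d0 by (cases n) auto
    obtain s where s: "0 < s" "\<And>z::complex. z \<in> cball 0 s - {0} \<Longrightarrow> (0::complex) \<noteq> 0"
    proof (rule powser_0_nonzero[of 1 0 "\<lambda>n. g n - h n" "\<lambda>_. 0" n])
      show "(\<lambda>n. (g n - h n) * (z - 0) ^ n) sums 0" if "norm (z - 0) < 1" for z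
        using d[of z] that by simp
    qed (use n \<open>n > 0\<close> in auto)
    from s(2)[of "of_real s"] show False using s(1) by simp
  qed
  then show "g = h" by auto
qed

lemma mittag_leffler_sums:
  assumes "norm z < 1"
  shows "(\<lambda>n. mittag_leffler \<sigma> n * z ^ n) sums (((1 + z) / (1 - z)) powr \<sigma>)"
  using theI'[OF mittag_leffler_ex1[of \<sigma>]] assms unfolding mittag_leffler_def by blast

text \<open>
  Connection coefficients between \<open>C\<^sub>k\<^sup>\<lambda>(x) / (2\<^sup>k (x - 1)\<^sup>k)\<close> and the
  \<open>C\<^sub>m\<^sup>\<mu>(1/x) / (2\<^sup>m (1 - 1/x)\<^sup>m)\<close> with \<open>\<mu> = k - m + \<lambda>\<close>, and back. Since \<open>m + \<mu> = k + \<lambda>\<close>,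
  composing the two pairs the parameter \<open>\<lambda>\<close> at \<open>(k, m)\<close> with \<open>\<mu>\<close> at \<open>(m, n)\<close>.
  The denominators for all \<open>m \<le> k\<close> are nonzero iff the one for \<open>m = 0\<close>,
  \<open>pochhammer (k + 2 * \<lambda>) k\<close>, is; otherwise the coefficient is only meaningful as a limit
  in \<open>\<lambda>\<close> (possibly infinite, with poles cancelling in the sum over \<open>m\<close>).
\<close>

definition gegenbauer_conn :: "nat \<Rightarrow> nat \<Rightarrow> complex \<Rightarrow> complex" where
  "gegenbauer_conn k m lam =
     mittag_leffler (of_nat k + lam - 1/2) (k - m) * pochhammer lam (k - m)
       / pochhammer (of_nat k + 2 * lam) (k - m)"

definition gegenbauer_conn_inv :: "nat \<Rightarrow> nat \<Rightarrow> complex \<Rightarrow> complex" where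
  "gegenbauer_conn_inv k m lam =
     mittag_leffler (1/2 - of_nat k - lam) (k - m) * pochhammer lam (k - m)
       / pochhammer (of_nat k + 2 * lam) (k - m)"

end

theory Submission
  imports Defs
begin

text \<open>
  Put \<open>\<sigma> = k + \<lambda> - 1/2\<close> and \<open>w = (x + 1) / (x - 1)\<close>. Passing from \<open>(k, \<lambda>)\<close> to
  \<open>(m, k - m + \<lambda>)\<close> does not change \<open>\<sigma>\<close>, and up to the explicit factor
  \<open>(\<lambda>)\<^sub>k / (k + 2\<lambda>)\<^sub>k\<close> the scaled Gegenbauer polynomials along such a line of parameters
  are Taylor coefficients of one and the same function:
  \<open>C\<^sub>k\<^sup>\<lambda>(x) / (2\<^sup>k (x - 1)\<^sup>k)\<close> is the coefficient of \<open>z\<^sup>k\<close> in \<open>((1 + w z) (1 + z)) powr \<sigma>\<close>,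
  and \<open>C\<^sub>k\<^sup>\<lambda>(1/x) / (2\<^sup>k (1 - 1/x)\<^sup>k)\<close> the one in \<open>((1 + w z) (1 - z)) powr \<sigma>\<close>.
  The quotient of the two functions is \<open>((1 + z) / (1 - z)) powr \<sigma>\<close>, the generating function of
  the Mittag-Leffler polynomials. So both connection formulas are the multiplication of a power
  series by this quotient or by its reciprocal, and they invert each other since
  \<open>g(\<sigma>)\<close> and \<open>g(- \<sigma>)\<close> have reciprocal generating functions.

  The coefficient formula is \<open>gegenbauer_coeff\<close>. With \<open>a\<close>, \<open>d\<close> such that the argument is
  \<open>a / d\<close>, it comes from \<open>(1 + (a + d) z) (1 + (a - d) z) = (1 + a z)\<^sup>2 - d\<^sup>2 z\<^sup>2\<close>: expanding
  the \<open>\<sigma>\<close>-th power of the right-hand side in powers of \<open>d\<^sup>2 z\<^sup>2\<close> gives, up to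
  the factor above, the terms of the sum defining \<open>C\<^sub>k\<^sup>\<lambda>(a / d)\<close>. Replacing \<open>x\<close> by \<open>1 / x\<close> only interchanges \<open>a\<close> and \<open>d\<close>, which
  turns the factor \<open>1 + z\<close> into \<open>1 - z\<close>. The lemma \<open>conn_sum_eq_coeff\<close> explains why the
  quotients of Pochhammer symbols are compatible with the multiplication of power series.

  The zeros of \<open>l \<mapsto> (k + 2l)\<^sub>k\<close> are finitely many. Off them the formulas hold as they stand, and
  their left-hand sides are polynomials in \<open>l\<close>. So at every \<open>\<lambda>\<close>, exceptional or not, they hold in
  the limit.
\<close>

section \<open>Binomial series\<close>

text \<open>
  The formal version of \<open>(1 + a X) powr \<sigma>\<close>. It is written down by its coefficients, not as a
  composition with \<open>a X\<close>, so that products unfold directly to sums over \<open>gchoose\<close>.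
\<close>

definition binomial_fps :: "'a::field_char_0 \<Rightarrow> 'a \<Rightarrow> 'a fps" where
  "binomial_fps a \<sigma> = Abs_fps (\<lambda>n. (\<sigma> gchoose n) * a ^ n)"

lemma binomial_fps_nth [simp]: "fps_nth (binomial_fps a \<sigma>) n = (\<sigma> gchoose n) * a ^ n"
  by (simp add: binomial_fps_def)

lemma binomial_fps_add: "binomial_fps a (\<sigma> + \<tau>) = binomial_fps a \<sigma> * binomial_fps a \<tau>"
proof (rule fps_ext)
  fix n
  have "fps_nth (binomial_fps a \<sigma> * binomial_fps a \<tau>) n =
      (\<Sum>i=0..n. (\<sigma> gchoose i) * (\<tau> gchoose (n - i)) * a ^ n)"
    unfolding fps_mult_nth
    by (rule sum.cong) (simp_all add: mult_ac flip: power_add)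
  also have "\<dots> = fps_nth (binomial_fps a (\<sigma> + \<tau>)) n"
    by (simp add: gbinomial_Vandermonde flip: sum_distrib_right)
  finally show "fps_nth (binomial_fps a (\<sigma> + \<tau>)) n =
      fps_nth (binomial_fps a \<sigma> * binomial_fps a \<tau>) n" ..
qed

lemma binomial_fps_0 [simp]: "binomial_fps a 0 = 1"
  by (rule fps_ext) (simp add: gbinomial_0_left)

lemma binomial_fps_mult_minus [simp]: "binomial_fps a \<sigma> * binomial_fps a (- \<sigma>) = 1"
  by (simp flip: binomial_fps_add)

lemma binomial_fps_of_nat: "binomial_fps a (of_nat n) = (1 + fps_const a * fps_X) ^ n"
proof (induction n)
  case (Suc n)
  have "binomial_fps a 1 = 1 + fps_const a * fps_X"
  proof (rule fps_ext)
    fix m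
    have "(1::'a) gchoose m = of_nat (1 choose m)"
      by (simp only: binomial_gbinomial of_nat_1)
    moreover have "m = 0 \<or> m = 1 \<or> 1 < m"
      by auto
    ultimately show "fps_nth (binomial_fps a 1) m = fps_nth (1 + fps_const a * fps_X) m"
      by (auto simp: binomial_eq_0)
  qed
  with Suc show ?case
    by (simp add: binomial_fps_add mult_ac)
qed simp

section \<open>Polynomial dependence on a parameter\<close>

text \<open>
  Identities between generalised binomial coefficients are polynomial identities in the upper
  parameter, so that it suffices to verify them at natural numbers.
\<close>

definition is_poly_fun :: "('a::comm_ring_1 \<Rightarrow> 'a) \<Rightarrow> bool" where
  "is_poly_fun f \<longleftrightarrow> (\<exists>p. \<forall>x. f x = poly p x)"

lemma is_poly_fun_id: "is_poly_fun (\<lambda>x. x)"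
  unfolding is_poly_fun_def by (rule exI[of _ "[:0, 1:]"]) simp

lemma is_poly_fun_const: "is_poly_fun (\<lambda>x. c)"
  unfolding is_poly_fun_def by (rule exI[of _ "[:c:]"]) simp

lemma is_poly_fun_diff: "is_poly_fun f \<Longrightarrow> is_poly_fun g \<Longrightarrow> is_poly_fun (\<lambda>x. f x - g x)"
  unfolding is_poly_fun_def by (metis poly_diff)

lemma is_poly_fun_mult: "is_poly_fun f \<Longrightarrow> is_poly_fun g \<Longrightarrow> is_poly_fun (\<lambda>x. f x * g x)"
  unfolding is_poly_fun_def by (metis poly_mult)

lemma is_poly_fun_sum: "(\<And>i. i \<in> A \<Longrightarrow> is_poly_fun (f i)) \<Longrightarrow> is_poly_fun (\<lambda>x. \<Sum>i\<in>A. f i x)"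
proof -
  assume "\<And>i. i \<in> A \<Longrightarrow> is_poly_fun (f i)"
  then obtain p where "\<And>i x. i \<in> A \<Longrightarrow> f i x = poly (p i) x"
    unfolding is_poly_fun_def by metis
  then have "(\<Sum>i\<in>A. f i x) = poly (\<Sum>i\<in>A. p i) x" for x
    by (simp add: poly_sum)
  then show ?thesis
    unfolding is_poly_fun_def by blast
qed

lemma is_poly_fun_prod: "(\<And>i. i \<in> A \<Longrightarrow> is_poly_fun (f i)) \<Longrightarrow> is_poly_fun (\<lambda>x. \<Prod>i\<in>A. f i x)"
proof -
  assume "\<And>i. i \<in> A \<Longrightarrow> is_poly_fun (f i)"
  then obtain p where "\<And>i x. i \<in> A \<Longrightarrow> f i x = poly (p i) x"
    unfolding is_poly_fun_def by metis
  then have "(\<Prod>i\<in>A. f i x) = poly (\<Prod>i\<in>A. p i) x" for x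
    by (simp add: poly_prod)
  then show ?thesis
    unfolding is_poly_fun_def by blast
qed

lemma is_poly_fun_gbinomial:
  fixes f :: "'a::field_char_0 \<Rightarrow> 'a"
  assumes "is_poly_fun f"
  shows "is_poly_fun (\<lambda>x. f x gchoose n)"
proof -
  have "(\<lambda>x. f x gchoose n) = (\<lambda>x. (\<Prod>i=0..<n. f x - of_nat i) * inverse (fact n))"
    by (simp add: gbinomial_prod_rev divide_inverse)
  then show ?thesis
    by (simp add: assms is_poly_fun_mult is_poly_fun_prod is_poly_fun_diff is_poly_fun_const)
qed

lemmas is_poly_fun_intros =
  is_poly_fun_id is_poly_fun_const is_poly_fun_diff is_poly_fun_mult is_poly_fun_sum
  is_poly_fun_gbinomial

lemma is_poly_fun_eqI:
  fixes f g :: "'a::{field_char_0} \<Rightarrow> 'a"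
  assumes "is_poly_fun f" "is_poly_fun g" and eq: "\<And>n. f (of_nat n) = g (of_nat n)"
  shows "f x = g x"
proof -
  obtain p where p: "\<And>x. f x - g x = poly p x"
    using is_poly_fun_diff[OF assms(1,2)] unfolding is_poly_fun_def by blast
  have "range of_nat \<subseteq> {x. poly p x = 0}"
    using eq by (auto simp flip: p)
  moreover have "infinite (range (of_nat :: nat \<Rightarrow> 'a))"
    by (simp add: inj_of_nat range_inj_infinite)
  ultimately have "p = 0"
    using poly_roots_finite finite_subset by blast
  then show ?thesis
    using p[of x] by simp
qed

section \<open>Generating function of the Gegenbauer polynomials\<close>

text \<open>
  For a natural exponent \<open>\<sigma> = n\<close> the product is
  \<open>((1 + a X)\<^sup>2 - d\<^sup>2 X\<^sup>2)\<^sup>n\<close>, and the binomial theorem gives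
  \<open>\<Sum>j. (n choose j) (- d\<^sup>2 X\<^sup>2)\<^sup>j (1 + a X)\<^bsup>2 (n - j)\<^esup>\<close>. Both sides depend
  polynomially on \<open>\<sigma>\<close>.
\<close>

lemma binomial_fps_conjugate_product:
  fixes a d \<sigma> :: "'a::field_char_0"
  shows "fps_nth (binomial_fps (a + d) \<sigma> * binomial_fps (a - d) \<sigma>) k =
    (\<Sum>j\<le>k div 2. (\<sigma> gchoose j) * (- (d\<^sup>2)) ^ j
        * ((2 * \<sigma> - 2 * of_nat j) gchoose (k - 2 * j)) * a ^ (k - 2 * j))"
    (is "?L \<sigma> = ?R \<sigma>")
proof (rule is_poly_fun_eqI[of ?L ?R])
  show "is_poly_fun ?L"
    unfolding fps_mult_nth binomial_fps_nth by (intro is_poly_fun_intros)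
  show "is_poly_fun ?R"
    by (intro is_poly_fun_intros)
  fix n :: nat
  define T where "T j = (of_nat n gchoose j) * (- (d\<^sup>2)) ^ j *
      ((2 * of_nat n - 2 * of_nat j) gchoose (k - 2 * j)) * a ^ (k - 2 * j)" for j
  have lin: "1 + fps_const (a + d) * fps_X = (1 + fps_const a * fps_X) + fps_const d * fps_X"
    "1 + fps_const (a - d) * fps_X = (1 + fps_const a * fps_X) - fps_const d * fps_X"
    by (simp_all add: algebra_simps flip: fps_const_add fps_const_sub)
  have "binomial_fps (a + d) (of_nat n) * binomial_fps (a - d) (of_nat n) =
      ((1 + fps_const a * fps_X)\<^sup>2 - fps_const (d\<^sup>2) * fps_X\<^sup>2) ^ n"
    unfolding binomial_fps_of_nat lin power_mult_distrib[symmetric]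
    by (simp add: algebra_simps power2_eq_square flip: fps_const_mult)
  also have "\<dots> = (fps_const (- (d\<^sup>2)) * fps_X\<^sup>2 + (1 + fps_const a * fps_X)\<^sup>2) ^ n"
    by (simp add: algebra_simps flip: fps_const_neg)
  also have "\<dots> = (\<Sum>j\<le>n. fps_const (of_nat (n choose j) * (- (d\<^sup>2)) ^ j)
      * (fps_X ^ (2 * j) * binomial_fps a (of_nat (2 * (n - j)))))"
    unfolding binomial_ring binomial_fps_of_nat power_mult
    by (rule sum.cong) (simp_all add: power_mult_distrib fps_of_nat mult_ac
          flip: fps_const_mult fps_const_power)
  finally have "?L (of_nat n) = (\<Sum>j\<le>n. if 2 * j \<le> k then T j else 0)"
    by (auto simp: fps_sum_nth fps_X_power_mult_nth T_def of_nat_diff binomial_gbinomial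
        right_diff_distrib mult_ac intro!: sum.cong)
  also have "\<dots> = (\<Sum>j\<in>{..n} \<inter> {..k div 2}. T j)"
    by (subst sum.inter_restrict) (auto intro!: sum.cong)
  also have "\<dots> = (\<Sum>j\<le>k div 2. T j)"
    \<comment> \<open>the factor \<open>n choose j\<close> vanishes for \<open>j > n\<close>\<close>
    by (rule sum.mono_neutral_left) (auto simp: T_def binomial_eq_0 simp flip: binomial_gbinomial)
  finally show "?L (of_nat n) = ?R (of_nat n)"
    by (simp add: T_def)
qed

text \<open>
  The match between the coefficients of the Gegenbauer polynomial and those of the expanded power.
  With \<open>c = k - j + \<lambda>\<close>, split \<open>(\<lambda>)\<^sub>k\<close> after \<open>k - j\<close> factors and \<open>(k + 2\<lambda>)\<^sub>k\<close> after
  \<open>k - 2j\<close> factors. The duplication formula turns the remainder \<open>(2c)\<^bsub>2j\<^esub>\<close> of the latter into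
  \<open>4\<^sup>j (c)\<^sub>j (c + 1/2)\<^sub>j\<close>, where \<open>(c)\<^sub>j\<close> is the remainder of the former and
  \<open>(c + 1/2)\<^sub>j\<close> the numerator of the first binomial coefficient. No Pochhammer symbol stands in
  a denominator, so that exceptional parameters are included.
\<close>

lemma pochhammer_gbinomial_identity:
  fixes lam :: "'a::field_char_0"
  assumes "2 * j \<le> k"
  shows "pochhammer (of_nat k + 2 * lam) k * pochhammer lam (k - j) / (4 ^ j * fact j * fact (k - 2 * j)) =
    pochhammer lam k * ((of_nat k + lam - 1/2) gchoose j)
      * ((2 * (of_nat k + lam - 1/2) - 2 * of_nat j) gchoose (k - 2 * j))"
proof -
  define c where "c = of_nat (k - j) + lam"
  have 1: "pochhammer lam k = pochhammer lam (k - j) * pochhammer c j"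
    using pochhammer_product'[of lam "k - j" j] assms by (simp add: c_def add.commute)
  have "of_nat k + 2 * lam + of_nat (k - 2 * j) = 2 * c"
    using assms by (simp add: c_def of_nat_diff algebra_simps)
  then have 2: "pochhammer (of_nat k + 2 * lam) k =
      pochhammer (of_nat k + 2 * lam) (k - 2 * j) * (4 ^ j * pochhammer c j * pochhammer (c + 1/2) j)"
    using pochhammer_product'[of "of_nat k + 2 * lam" "k - 2 * j" "2 * j"] assms
    by (simp add: pochhammer_double power_mult)
  have 3: "(of_nat k + lam - 1/2) gchoose j = pochhammer (c + 1/2) j / fact j"
    using assms by (simp add: gbinomial_pochhammer' c_def of_nat_diff algebra_simps)
  have 4: "(2 * (of_nat k + lam - 1/2) - 2 * of_nat j) gchoose (k - 2 * j) =
      pochhammer (of_nat k + 2 * lam) (k - 2 * j) / fact (k - 2 * j)"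
    using assms by (simp add: gbinomial_pochhammer' of_nat_diff algebra_simps)
  show ?thesis
    unfolding 1 2 3 4 by (simp add: field_simps)
qed

text \<open>
  The factor \<open>(d / 2)\<^sup>k\<close> makes the monomial \<open>(2 a / d)\<^bsup>k - 2j\<^esup>\<close> of the Gegenbauer polynomial
  homogeneous: it becomes \<open>a\<^bsup>k - 2j\<^esup> (d\<^sup>2 / 4)\<^sup>j\<close>.
\<close>

lemma gegenbauer_coeff:
  fixes a d lam :: complex
  assumes "d \<noteq> 0"
  shows "pochhammer (of_nat k + 2 * lam) k * (gegenbauer k lam (a / d) * (d / 2) ^ k) =
    pochhammer lam k *
      fps_nth (binomial_fps (a + d) (of_nat k + lam - 1/2)
             * binomial_fps (a - d) (of_nat k + lam - 1/2)) k"
  unfolding binomial_fps_conjugate_product gegenbauer_def sum_distrib_left sum_distrib_right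
proof (rule sum.cong[OF refl])
  fix j assume "j \<in> {..k div 2}"
  then have j: "2 * j \<le> k" by auto
  have "(2 * (a / d)) ^ (k - 2 * j) * (d / 2) ^ k =
      (2 * (a / d)) ^ (k - 2 * j) * ((d / 2) ^ (k - 2 * j) * (d / 2) ^ (2 * j))"
    using j by (simp flip: power_add)
  also have "\<dots> = (2 * (a / d) * (d / 2)) ^ (k - 2 * j) * ((d / 2) ^ 2) ^ j"
    by (simp only: power_mult power_mult_distrib mult.assoc)
  also have "\<dots> = a ^ (k - 2 * j) * (d\<^sup>2) ^ j / 4 ^ j"
    using assms by (simp add: power_divide)
  finally have p: "(2 * (a / d)) ^ (k - 2 * j) * (d / 2) ^ k = a ^ (k - 2 * j) * (d\<^sup>2) ^ j / 4 ^ j" .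
  have "pochhammer (of_nat k + 2 * lam) k *
      ((- 1) ^ j * pochhammer lam (k - j) / (fact j * fact (k - 2 * j)) *
        (2 * (a / d)) ^ (k - 2 * j) * (d / 2) ^ k) =
      pochhammer (of_nat k + 2 * lam) k * pochhammer lam (k - j) / (4 ^ j * fact j * fact (k - 2 * j))
        * ((- 1) ^ j * (d\<^sup>2) ^ j * a ^ (k - 2 * j))"
    unfolding mult.assoc p by (simp add: mult_ac)
  also have "\<dots> = pochhammer lam k *
      ((of_nat k + lam - 1/2 gchoose j) * (- (d\<^sup>2)) ^ j *
       (2 * (of_nat k + lam - 1/2) - 2 * of_nat j gchoose (k - 2 * j)) * a ^ (k - 2 * j))"
    unfolding pochhammer_gbinomial_identity[OF j] power_minus[of "d\<^sup>2"] by (simp only: mult_ac)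
  finally show "pochhammer (of_nat k + 2 * lam) k *
      ((- 1) ^ j * pochhammer lam (k - j) / (fact j * fact (k - 2 * j)) *
        (2 * (a / d)) ^ (k - 2 * j) * (d / 2) ^ k) = \<dots>" .
qed

section \<open>Mittag-Leffler polynomials\<close>

text \<open>
  The formal version of \<open>((1 + X) / (1 - X)) powr \<sigma>\<close>. As a product of binomial series it
  reduces the algebra of Mittag-Leffler polynomials to that of powers.
\<close>

definition mittag_leffler_fps :: "complex \<Rightarrow> complex fps" where
  "mittag_leffler_fps \<sigma> = binomial_fps 1 \<sigma> * binomial_fps (- 1) (- \<sigma>)"

text \<open>
  In the right half plane the arguments lie in \<open>(- \<pi>/2, \<pi>/2)\<close>, so that their difference does
  not leave the range of the principal branch.
\<close>

lemma powr_quotient_right_half_plane: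
  fixes u v \<sigma> :: complex
  assumes "Re u > 0" "Re v > 0"
  shows "(u / v) powr \<sigma> = u powr \<sigma> * v powr (- \<sigma>)"
proof -
  have nz: "u \<noteq> 0" "v \<noteq> 0" using assms by auto
  have "\<bar>Im (Ln u)\<bar> < pi / 2" "\<bar>Im (Ln v)\<bar> < pi / 2"
    using assms nz Re_Ln_pos_lt by blast+
  moreover have inv: "Ln (inverse v) = - Ln v"
    using assms by (intro Ln_inverse) (auto simp: complex_nonpos_Reals_iff)
  ultimately have "Ln (u * inverse v) = Ln u + Ln (inverse v)"
    using nz by (intro Ln_times_simple) auto
  then have "\<sigma> * Ln (u / v) = \<sigma> * Ln u + (- \<sigma>) * Ln v"
    unfolding inv divide_inverse by (simp only: distrib_left mult_minus_left mult_minus_right)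
  then show ?thesis
    using nz by (simp only: powr_def exp_add) simp
qed

text \<open>
  The coefficients are the Cauchy product of the absolutely convergent binomial series of
  \<open>(1 + z) powr \<sigma>\<close> and \<open>(1 - z) powr (- \<sigma>)\<close>, and the Mittag-Leffler polynomials are determined
  by the function that their series represents.
\<close>

lemma mittag_leffler_fps_nth: "mittag_leffler \<sigma> n = fps_nth (mittag_leffler_fps \<sigma>) n"
proof -
  have "(\<lambda>n. fps_nth (mittag_leffler_fps \<sigma>) n * z ^ n) sums (((1 + z) / (1 - z)) powr \<sigma>)"
    if z: "norm z < 1" for z
  proof -
    have sm: "summable (\<lambda>n. norm ((\<tau> gchoose n) * w ^ n))" if "norm w < 1" for \<tau> w :: complex
      using that by (intro abs_summable_in_conv_radius) (simp add: conv_radius_gchoose)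
    have "(\<lambda>k. \<Sum>i\<le>k. ((\<sigma> gchoose i) * z ^ i) * ((- \<sigma> gchoose (k - i)) * (- z) ^ (k - i))) sums
        ((\<Sum>n. (\<sigma> gchoose n) * z ^ n) * (\<Sum>n. (- \<sigma> gchoose n) * (- z) ^ n))"
      using z by (intro Cauchy_product_sums sm) auto
    also have "(\<lambda>k. \<Sum>i\<le>k. ((\<sigma> gchoose i) * z ^ i) * ((- \<sigma> gchoose (k - i)) * (- z) ^ (k - i))) =
        (\<lambda>n. fps_nth (mittag_leffler_fps \<sigma>) n * z ^ n)"
    proof
      fix n
      have "((\<sigma> gchoose i) * z ^ i) * ((- \<sigma> gchoose (n - i)) * (- z) ^ (n - i)) =
          (\<sigma> gchoose i) * 1 ^ i * ((- \<sigma> gchoose (n - i)) * (- 1) ^ (n - i)) * z ^ n"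
        if "i \<le> n" for i
      proof -
        have "z ^ n = z ^ i * z ^ (n - i)"
          using that by (simp flip: power_add)
        then show ?thesis
          by (simp add: power_minus[of z])
      qed
      then show "(\<Sum>i\<le>n. ((\<sigma> gchoose i) * z ^ i) * ((- \<sigma> gchoose (n - i)) * (- z) ^ (n - i))) =
          fps_nth (mittag_leffler_fps \<sigma>) n * z ^ n"
        unfolding mittag_leffler_fps_def fps_mult_nth binomial_fps_nth sum_distrib_right atMost_atLeast0
        by (intro sum.cong refl) simp
    qed
    also have "(\<Sum>n. (\<sigma> gchoose n) * z ^ n) = (1 + z) powr \<sigma>"
      using gen_binomial_complex[OF z] by (simp add: sums_iff)
    also have "(\<Sum>n. (- \<sigma> gchoose n) * (- z) ^ n) = (1 - z) powr (- \<sigma>)"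
      using gen_binomial_complex[of "- z" "- \<sigma>"] z by (simp add: sums_iff)
    also have "(1 + z) powr \<sigma> * (1 - z) powr (- \<sigma>) = ((1 + z) / (1 - z)) powr \<sigma>"
    proof (rule powr_quotient_right_half_plane[symmetric])
      show "Re (1 + z) > 0" "Re (1 - z) > 0"
        using z abs_Re_le_cmod[of z] by auto
    qed
    finally show ?thesis .
  qed
  then have "fps_nth (mittag_leffler_fps \<sigma>) = mittag_leffler \<sigma>"
    using mittag_leffler_ex1[of \<sigma>] mittag_leffler_sums by blast
  then show ?thesis
    by simp
qed

lemma mittag_leffler_fps_minus:
  "mittag_leffler_fps \<sigma> * mittag_leffler_fps (- \<sigma>) = 1"
proof -
  have "mittag_leffler_fps \<sigma> * mittag_leffler_fps (- \<sigma>) =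
      (binomial_fps 1 \<sigma> * binomial_fps 1 (- \<sigma>)) * (binomial_fps (- 1) (- \<sigma>) * binomial_fps (- 1) (- (- \<sigma>)))"
    by (simp add: mittag_leffler_fps_def mult_ac)
  then show ?thesis
    by (simp only: binomial_fps_mult_minus mult_1)
qed

lemma mittag_leffler_fps_mult_binomial:
  "mittag_leffler_fps \<sigma> * binomial_fps (- 1) \<sigma> = binomial_fps 1 \<sigma>"
proof -
  have "mittag_leffler_fps \<sigma> * binomial_fps (- 1) \<sigma> =
      binomial_fps 1 \<sigma> * (binomial_fps (- 1) \<sigma> * binomial_fps (- 1) (- \<sigma>))"
    by (simp add: mittag_leffler_fps_def mult_ac)
  then show ?thesis
    by (simp only: binomial_fps_mult_minus mult_1_right)
qed

lemma mittag_leffler_fps_minus_mult_binomial: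
  "mittag_leffler_fps (- \<sigma>) * binomial_fps 1 \<sigma> = binomial_fps (- 1) \<sigma>"
proof -
  have "mittag_leffler_fps (- \<sigma>) * (mittag_leffler_fps \<sigma> * binomial_fps (- 1) \<sigma>) = binomial_fps (- 1) \<sigma>"
    by (simp add: mittag_leffler_fps_minus mult.commute[of "mittag_leffler_fps (- \<sigma>)"] flip: mult.assoc)
  then show ?thesis
    by (simp only: mittag_leffler_fps_mult_binomial)
qed

section \<open>Connection sums as products of power series\<close>

text \<open>
  The part of the connection coefficients common to both directions, with \<open>i = k - m\<close>. At
  \<open>i = k\<close> it is the factor between a scaled Gegenbauer polynomial and the Taylor coefficient
  that represents it.
\<close>

definition conn_factor :: "nat \<Rightarrow> complex \<Rightarrow> nat \<Rightarrow> complex" where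
  "conn_factor k lam i = pochhammer lam i / pochhammer (of_nat k + 2 * lam) i"

text \<open>
  The parameters of \<open>conn_factor m (k - m + \<lambda>)\<close> continue both Pochhammer symbols where those of
  \<open>conn_factor k \<lambda> (k - m)\<close> stop, because
  \<open>m + 2 (k - m + \<lambda>) = (k + 2\<lambda>) + (k - m)\<close>.
\<close>

lemma conn_factor_mult:
  assumes "m \<le> k"
  shows "conn_factor k lam (k - m) * conn_factor m (of_nat (k - m) + lam) i = conn_factor k lam (k - m + i)"
proof -
  have "of_nat m + 2 * (of_nat (k - m) + lam) = of_nat k + 2 * lam + of_nat (k - m)"
    using assms by (simp add: of_nat_diff algebra_simps)
  then show ?thesis
    by (simp only: conn_factor_def pochhammer_product' add.commute[of lam] times_divide_times_eq)
qed

text \<open>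
  Since the factors multiply to one that does not depend on \<open>m\<close>, what remains of a connection sum
  is a Cauchy product.
\<close>

lemma conn_sum_eq_coeff:
  fixes G H :: "complex fps"
  assumes "n \<le> k"
  shows "(\<Sum>m=n..k. (fps_nth G (k - m) * conn_factor k lam (k - m))
            * (fps_nth H (m - n) * conn_factor m (of_nat (k - m) + lam) (m - n)))
        = conn_factor k lam (k - n) * fps_nth (G * H) (k - n)"
proof -
  have "(\<Sum>m=n..k. (fps_nth G (k - m) * conn_factor k lam (k - m))
            * (fps_nth H (m - n) * conn_factor m (of_nat (k - m) + lam) (m - n)))
      = (\<Sum>m=n..k. conn_factor k lam (k - n) * (fps_nth G (k - m) * fps_nth H (m - n)))"
  proof (rule sum.cong[OF refl])
    fix m assume "m \<in> {n..k}"
    then have "conn_factor k lam (k - n) =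
        conn_factor k lam (k - m) * conn_factor m (of_nat (k - m) + lam) (m - n)"
      by (subst conn_factor_mult) auto
    then show "(fps_nth G (k - m) * conn_factor k lam (k - m))
            * (fps_nth H (m - n) * conn_factor m (of_nat (k - m) + lam) (m - n)) =
        conn_factor k lam (k - n) * (fps_nth G (k - m) * fps_nth H (m - n))"
      by simp
  qed
  also have "\<dots> = conn_factor k lam (k - n) * (\<Sum>m=n..k. fps_nth G (k - m) * fps_nth H (m - n))"
    by (simp add: sum_distrib_left)
  also have "(\<Sum>m=n..k. fps_nth G (k - m) * fps_nth H (m - n)) =
      (\<Sum>i=0..k-n. fps_nth G i * fps_nth H (k - n - i))"
    by (rule sum.reindex_bij_witness[of _ "\<lambda>i. k - i" "\<lambda>m. k - m"]) (use assms in auto)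
  finally show ?thesis
    by (simp add: fps_mult_nth)
qed

lemma gegenbauer_conn_eq:
  "gegenbauer_conn k m lam =
    fps_nth (mittag_leffler_fps (of_nat k + lam - 1/2)) (k - m) * conn_factor k lam (k - m)"
  by (simp add: gegenbauer_conn_def conn_factor_def mittag_leffler_fps_nth)

lemma gegenbauer_conn_inv_eq:
  "gegenbauer_conn_inv k m lam =
    fps_nth (mittag_leffler_fps (- (of_nat k + lam - 1/2))) (k - m) * conn_factor k lam (k - m)"
  by (simp add: gegenbauer_conn_inv_def conn_factor_def mittag_leffler_fps_nth algebra_simps)


text \<open>The exponent \<open>\<sigma>\<close> is the same for all terms of a connection sum.\<close>

lemma sum_parameter_shift:
  assumes "m \<le> k"
  shows "of_nat m + (of_nat (k - m) + lam) - 1/2 = of_nat k + lam - (1/2 :: complex)"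
  using assms by (simp add: of_nat_diff)

lemma conn_factor_0 [simp]: "conn_factor k lam 0 = 1"
  by (simp add: conn_factor_def)

lemma gegenbauer_conn_inverse:
  assumes "n \<le> k"
  shows "(\<Sum>m=n..k. gegenbauer_conn k m lam * gegenbauer_conn_inv m n (of_nat (k - m) + lam))
             = (if n = k then 1 else 0)"
    and "(\<Sum>m=n..k. gegenbauer_conn_inv k m lam * gegenbauer_conn m n (of_nat (k - m) + lam))
             = (if n = k then 1 else 0)"
proof -
  define \<sigma> where "\<sigma> = of_nat k + lam - 1/2"
  have shift: "of_nat m + (of_nat (k - m) + lam) - 1/2 = \<sigma>" if "m \<in> {n..k}" for m
    using that sum_parameter_shift[of m k lam] by (simp add: \<sigma>_def)
  have "(\<Sum>m=n..k. gegenbauer_conn k m lam * gegenbauer_conn_inv m n (of_nat (k - m) + lam)) =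
      conn_factor k lam (k - n) * fps_nth (mittag_leffler_fps \<sigma> * mittag_leffler_fps (- \<sigma>)) (k - n)"
    unfolding conn_sum_eq_coeff[OF assms, symmetric] gegenbauer_conn_eq gegenbauer_conn_inv_eq
    by (rule sum.cong) (simp_all only: shift \<sigma>_def[symmetric])
  then show "(\<Sum>m=n..k. gegenbauer_conn k m lam * gegenbauer_conn_inv m n (of_nat (k - m) + lam))
             = (if n = k then 1 else 0)"
    using assms by (auto simp: mittag_leffler_fps_minus)
  have "(\<Sum>m=n..k. gegenbauer_conn_inv k m lam * gegenbauer_conn m n (of_nat (k - m) + lam)) =
      conn_factor k lam (k - n) * fps_nth (mittag_leffler_fps (- \<sigma>) * mittag_leffler_fps \<sigma>) (k - n)"
    unfolding conn_sum_eq_coeff[OF assms, symmetric] gegenbauer_conn_eq gegenbauer_conn_inv_eq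
    by (rule sum.cong) (simp_all only: shift \<sigma>_def[symmetric])
  then show "(\<Sum>m=n..k. gegenbauer_conn_inv k m lam * gegenbauer_conn m n (of_nat (k - m) + lam))
             = (if n = k then 1 else 0)"
    using assms by (auto simp: mittag_leffler_fps_minus mult.commute[of "mittag_leffler_fps (- \<sigma>)"])
qed

definition scaled_gegenbauer :: "nat \<Rightarrow> complex \<Rightarrow> complex \<Rightarrow> complex" where
  "scaled_gegenbauer k lam x = gegenbauer k lam x / (2 ^ k * (x - 1) ^ k)"

text \<open>
  This is not \<open>scaled_gegenbauer\<close> at \<open>1 / x\<close>: the denominator has \<open>1 - 1/x\<close> in place of
  \<open>1/x - 1\<close>, whence a factor \<open>(- 1)\<^sup>k\<close>.
\<close>

definition scaled_gegenbauer_inv :: "nat \<Rightarrow> complex \<Rightarrow> complex \<Rightarrow> complex" where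
  "scaled_gegenbauer_inv k lam x = gegenbauer k lam (1 / x) / (2 ^ k * (1 - 1 / x) ^ k)"

text \<open>
  The values \<open>a\<close>, \<open>d\<close> in the next two proofs are the solutions of \<open>a / d = x\<close>, \<open>a - d = 1\<close> and
  of \<open>a / d = 1 / x\<close>, \<open>a - d = - 1\<close>. They differ by interchanging \<open>a\<close> and \<open>d\<close>, so that
  \<open>a + d\<close> is the same.
\<close>

lemma scaled_gegenbauer_eq_coeff:
  assumes "x \<noteq> 1" "pochhammer (of_nat k + 2 * lam) k \<noteq> 0" "of_nat k + lam - 1/2 = \<sigma>"
  shows "scaled_gegenbauer k lam x = 
    fps_nth (binomial_fps ((x + 1) / (x - 1)) \<sigma> * binomial_fps 1 \<sigma>) k * conn_factor k lam k"
proof -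
  define a d where "a = x / (x - 1)" and "d = 1 / (x - 1)"
  have "x - 1 \<noteq> 0"
    using assms(1) by simp
  then have ad: "d \<noteq> 0" "a / d = x" "a + d = (x + 1) / (x - 1)" "a - d = 1"
    unfolding a_def d_def by (simp_all flip: add_divide_distrib diff_divide_distrib)
  have e: "scaled_gegenbauer k lam x = gegenbauer k lam (a / d) * (d / 2) ^ k"
    unfolding ad(2) scaled_gegenbauer_def
    unfolding d_def divide_divide_eq_left power_divide power_mult_distrib
    by (simp add: mult.commute)
  then show ?thesis
    using gegenbauer_coeff[OF ad(1), of k lam a] assms(2)
    unfolding ad(3,4) assms(3) e[symmetric] conn_factor_def
    by (simp add: nonzero_eq_divide_eq mult_ac)
qed

lemma scaled_gegenbauer_inv_eq_coeff:
  assumes "x \<noteq> 0" "x \<noteq> 1" "pochhammer (of_nat k + 2 * lam) k \<noteq> 0" "of_nat k + lam - 1/2 = \<sigma>"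
  shows "scaled_gegenbauer_inv k lam x = 
    fps_nth (binomial_fps ((x + 1) / (x - 1)) \<sigma> * binomial_fps (- 1) \<sigma>) k * conn_factor k lam k"
proof -
  define a d where "a = 1 / (x - 1)" and "d = x / (x - 1)"
  have "x - 1 \<noteq> 0"
    using assms(2) by simp
  then have ad: "d \<noteq> 0" "a / d = 1 / x" "a + d = (x + 1) / (x - 1)" "a - d = - 1" "1 - 1 / x = 1 / d"
    unfolding a_def d_def
    by (simp_all add: assms(1) divide_simps)
  have e: "scaled_gegenbauer_inv k lam x = gegenbauer k lam (a / d) * (d / 2) ^ k"
    unfolding ad scaled_gegenbauer_inv_def by (simp add: power_divide power_mult_distrib)
  then show ?thesis
    using gegenbauer_coeff[OF ad(1), of k lam a] assms(3)
    unfolding ad(3,4) assms(4) e[symmetric] conn_factor_def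
    by (simp add: nonzero_eq_divide_eq mult_ac)
qed

text \<open>
  The coefficient formula is applied to each term of the connection sum. The denominators that
  occur there are factors of the one at \<open>m = 0\<close>.
\<close>

lemma pochhammer_shift_nonzero:
  fixes lam :: complex
  assumes "pochhammer (of_nat k + 2 * lam) k \<noteq> 0" "m \<le> k"
  shows "pochhammer (of_nat m + 2 * (of_nat (k - m) + lam)) m \<noteq> 0"
proof -
  have arg: "of_nat m + 2 * (of_nat (k - m) + lam) = of_nat k + 2 * lam + of_nat (k - m)"
    using assms(2) by (simp add: of_nat_diff algebra_simps)
  show ?thesis
    using assms(1) unfolding arg pochhammer_product[OF diff_le_self[of k m], of "of_nat k + 2 * lam"]
    using assms(2) by simp
qed

text \<open>
  In terms of generating functions: multiplication by \<open>((1 + z) / (1 - z)) powr \<sigma>\<close> takes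
  \<open>((1 + w z) (1 - z)) powr \<sigma>\<close> to \<open>((1 + w z) (1 + z)) powr \<sigma>\<close>, and multiplication by its
  reciprocal goes back.
\<close>

lemma gegenbauer_connection:
  fixes x lam :: complex
  assumes x: "x \<noteq> 0" "x \<noteq> 1" and nz: "pochhammer (of_nat k + 2 * lam) k \<noteq> 0"
  shows "scaled_gegenbauer k lam x =
      (\<Sum>m=0..k. gegenbauer_conn k m lam * scaled_gegenbauer_inv m (of_nat (k - m) + lam) x)" (is ?A)
    and "scaled_gegenbauer_inv k lam x =
      (\<Sum>m=0..k. gegenbauer_conn_inv k m lam * scaled_gegenbauer m (of_nat (k - m) + lam) x)" (is ?B)
proof -
  define \<sigma> w where "\<sigma> = of_nat k + lam - 1/2" and "w = (x + 1) / (x - 1)"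
  have shift: "of_nat m + (of_nat (k - m) + lam) - 1/2 = \<sigma>" if "m \<in> {0..k}" for m
    using that sum_parameter_shift[of m k lam] by (simp add: \<sigma>_def)
  have nz': "pochhammer (of_nat m + 2 * (of_nat (k - m) + lam)) m \<noteq> 0" if "m \<in> {0..k}" for m
    using that nz pochhammer_shift_nonzero by simp
  have "(\<Sum>m=0..k. gegenbauer_conn k m lam * scaled_gegenbauer_inv m (of_nat (k - m) + lam) x) =
      conn_factor k lam (k - 0)
        * fps_nth (mittag_leffler_fps \<sigma> * (binomial_fps w \<sigma> * binomial_fps (- 1) \<sigma>)) (k - 0)"
    unfolding conn_sum_eq_coeff[OF le0, symmetric] gegenbauer_conn_eq
    by (rule sum.cong)
      (simp_all only: scaled_gegenbauer_inv_eq_coeff[OF x nz' shift] \<sigma>_def[symmetric] w_def[symmetric] diff_zero)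
  also have "mittag_leffler_fps \<sigma> * (binomial_fps w \<sigma> * binomial_fps (- 1) \<sigma>) =
      binomial_fps w \<sigma> * binomial_fps 1 \<sigma>"
    by (subst mult.left_commute) (simp only: mittag_leffler_fps_mult_binomial)
  finally show ?A
    using scaled_gegenbauer_eq_coeff[OF x(2) nz \<sigma>_def[symmetric]] by (simp add: w_def)
  have "(\<Sum>m=0..k. gegenbauer_conn_inv k m lam * scaled_gegenbauer m (of_nat (k - m) + lam) x) =
      conn_factor k lam (k - 0)
        * fps_nth (mittag_leffler_fps (- \<sigma>) * (binomial_fps w \<sigma> * binomial_fps 1 \<sigma>)) (k - 0)"
    unfolding conn_sum_eq_coeff[OF le0, symmetric] gegenbauer_conn_inv_eq
    by (rule sum.cong)
      (simp_all only: scaled_gegenbauer_eq_coeff[OF x(2) nz' shift] \<sigma>_def[symmetric] w_def[symmetric] diff_zero)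
  also have "mittag_leffler_fps (- \<sigma>) * (binomial_fps w \<sigma> * binomial_fps 1 \<sigma>) =
      binomial_fps w \<sigma> * binomial_fps (- 1) \<sigma>"
    by (subst mult.left_commute) (simp only: mittag_leffler_fps_minus_mult_binomial)
  finally show ?B
    using scaled_gegenbauer_inv_eq_coeff[OF x nz \<sigma>_def[symmetric]] by (simp add: w_def)
qed

section \<open>Exceptional parameters\<close>

lemma eventually_pochhammer_nonzero:
  fixes lam :: complex
  shows "\<forall>\<^sub>F l in at lam. pochhammer (of_nat k + 2 * l) k \<noteq> 0"
proof -
  have "{l::complex. pochhammer (of_nat k + 2 * l) k = 0} \<subseteq> (\<lambda>i. (- of_nat i - of_nat k) / 2) ` {..<k}"
  proof
    fix l :: complex assume "l \<in> {l. pochhammer (of_nat k + 2 * l) k = 0}"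
    then obtain i where "i < k" "of_nat k + 2 * l = - of_nat i"
      by (auto simp: pochhammer_eq_0_iff)
    then show "l \<in> (\<lambda>i. (- of_nat i - of_nat k) / 2) ` {..<k}"
      by (intro image_eqI[of _ _ i]) (simp_all add: field_simps)
  qed
  then have "finite {l::complex. pochhammer (of_nat k + 2 * l) k = 0}"
    by (rule finite_subset) simp
  then have "\<not> lam islimpt {l. pochhammer (of_nat k + 2 * l) k = 0}"
    by (rule islimpt_finite)
  then show ?thesis
    by (simp add: islimpt_iff_eventually)
qed

lemma tendsto_gegenbauer: "((\<lambda>l. gegenbauer k l x) \<longlongrightarrow> gegenbauer k lam x) (at lam)"
  unfolding gegenbauer_def
  by (intro tendsto_intros isCont_pochhammer[unfolded isCont_def]) auto


theorem corollary9:
  fixes lam :: complex and k :: nat and x :: real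
  assumes "x \<noteq> 0" and "x \<noteq> 1"
  shows
    "(pochhammer (of_nat k + 2 * lam) k \<noteq> 0 \<longrightarrow>
        gegenbauer k lam x / (2 ^ k * (x - 1) ^ k) =
          (\<Sum>m=0..k. gegenbauer_conn k m lam
             * (gegenbauer m (of_nat (k - m) + lam) (1 / x) / (2 ^ m * (1 - 1 / x) ^ m))) \<and>
        gegenbauer k lam (1 / x) / (2 ^ k * (1 - 1 / x) ^ k) =
          (\<Sum>m=0..k. gegenbauer_conn_inv k m lam
             * (gegenbauer m (of_nat (k - m) + lam) x / (2 ^ m * (x - 1) ^ m))) \<and>
        (\<forall>n\<le>k.
           (\<Sum>m=n..k. gegenbauer_conn k m lam * gegenbauer_conn_inv m n (of_nat (k - m) + lam))
             = (if n = k then 1 else 0) \<and>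
           (\<Sum>m=n..k. gegenbauer_conn_inv k m lam * gegenbauer_conn m n (of_nat (k - m) + lam))
             = (if n = k then 1 else 0))) \<and>
     ((\<lambda>l. \<Sum>m=0..k. gegenbauer_conn k m l
          * (gegenbauer m (of_nat (k - m) + l) (1 / x) / (2 ^ m * (1 - 1 / x) ^ m)))
        \<longlongrightarrow> gegenbauer k lam x / (2 ^ k * (x - 1) ^ k)) (at lam) \<and>
     ((\<lambda>l. \<Sum>m=0..k. gegenbauer_conn_inv k m l
          * (gegenbauer m (of_nat (k - m) + l) x / (2 ^ m * (x - 1) ^ m)))
        \<longlongrightarrow> gegenbauer k lam (1 / x) / (2 ^ k * (1 - 1 / x) ^ k)) (at lam)"
proof -
  define z where "z = complex_of_real x"
  have z: "z \<noteq> 0" "z \<noteq> 1"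
    using assms by (auto simp: z_def)
  have S: "gegenbauer m l x / (2 ^ m * (x - 1) ^ m) = scaled_gegenbauer m l z"
    "gegenbauer m l (1 / x) / (2 ^ m * (1 - 1 / x) ^ m) = scaled_gegenbauer_inv m l z" for m l
    by (simp_all add: scaled_gegenbauer_def scaled_gegenbauer_inv_def z_def)
  have lim: "((\<lambda>l. scaled_gegenbauer k l z) \<longlongrightarrow> scaled_gegenbauer k lam z) (at lam)"
    "((\<lambda>l. scaled_gegenbauer_inv k l z) \<longlongrightarrow> scaled_gegenbauer_inv k lam z) (at lam)"
    unfolding scaled_gegenbauer_def scaled_gegenbauer_inv_def divide_inverse[of "gegenbauer _ _ _"]
    by (intro tendsto_mult_right tendsto_gegenbauer)+
  have ev: "\<forall>\<^sub>F l in at lam. scaled_gegenbauer k l z =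
      (\<Sum>m=0..k. gegenbauer_conn k m l * scaled_gegenbauer_inv m (of_nat (k - m) + l) z)"
    "\<forall>\<^sub>F l in at lam. scaled_gegenbauer_inv k l z =
      (\<Sum>m=0..k. gegenbauer_conn_inv k m l * scaled_gegenbauer m (of_nat (k - m) + l) z)"
    by (rule eventually_mono[OF eventually_pochhammer_nonzero[of k lam]],
        rule gegenbauer_connection[OF z], assumption)+
  show ?thesis
    unfolding S
    using gegenbauer_connection[OF z, of k lam] gegenbauer_conn_inverse
      Lim_transform_eventually[OF lim(1) ev(1)] Lim_transform_eventually[OF lim(2) ev(2)]
    by blast
qed

end
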